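(* Let $G$ be a nonempty Dots & Boxes position consisting of loops and long chains. Write $v=v(G)$, $c=c(G)$, and let $\theta$, $f$, $s$ be the numbers of $3$-chains, $4$-loops and $6$-loops in $G$. Then each of the following holds: (1) if $c\ge 2$ then $v=c$; (2) if $c=0$, and $G$ has a $4$-loop, and $G\ne 4_\ell+3+3$, then $v=0$; (3) if $\theta=0$, or if $\theta=1$ and $\mathrm{size}(G)\equiv 3\pmod 4$, then $$v=\Phi^f\,\Theta^{\theta'}\,\Sigma^s\bigl(c(G_0)\bigr),$$ where $G_0$ is the core of $G$ and $\theta'\in\{0,1\}$ is the number of $3$-chains in $G-G_0$. In all other cases (when none of the hypotheses of (1), (2), (3) holds), $v=1$ if $\mathrm{size}(G)$ is odd and $v=2$ if $\mathrm{size}(G)$ is even.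
   Context: Positions. A (Dots & Boxes) position $G$ consisting of loops and long chains is a finite multiset of components, each of which is either a chain of some integer length $\ge 3$ (a "long chain", or just "chain") or a loop of some even integer length $\ge 4$. All components are unopened. An $N$-chain is written $N$ and an $N$-loop is written $N_\ell$; positions are written additively (e.g. $3+4_\ell+8_\ell$ is a $3$-chain, a $4$-loop and an $8$-loop), and subtraction denotes removal of components. $\mathrm{size}(G)$ is the sum of the lengths of the components (the number of unclaimed boxes); $\mathrm{size}(C)$ is the length of the component $C$. Play and value. In a nonempty position the player to move (the opener) must choose a component $C$ to open. The other player (the controller) then either gives up control, i.e. captures all boxes of $C$ and becomes the opener in $G-C$, or keeps control, i.e. captures all but $2$ boxes of $C$ if $C$ is a chain (all but $4$ if $C$ is a loop), the leftover boxes being captured by the opener, who is then again the opener in $G-C$. Each player maximizes the number of boxes he captures. The value $v(G)$ is the margin by which the controller outscores the opener in $G$ under optimal play, and $v(G;C)$ is this margin given that the opener has just opened $C$. So $v(\emptyset)=0$, $v(G)=\min_C v(G;C)$ over the components $C$ of a nonempty $G$, and $$v(G;C)=\max\{\mathrm{size}(C)-2k+v(G-C),\ \mathrm{size}(C)-v(G-C)\}=(\mathrm{size}(C)-k)+|v(G-C)-k|,$$ with $k=2$ if $C$ is a chain and $k=4$ if $C$ is a loop. Controlled value. $c(G)=\mathrm{size}(G)-4(\text{number of chains})-8(\text{number of loops})+\mathrm{tb}(G)$, where the terminal bonus $\mathrm{tb}(G)$ is $0$ if $G$ is empty; $8$ if $G$ consists of one or more loops and nothing else; $6$ if $G$ consists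 of one or more loops and one or more $3$-chains and nothing else; and $4$ otherwise. Core. If $G$ has at most one $3$-chain, its core $G_0$ is the union of the following components of $G$: all loops of length $\ge 8$; and either all chains of length $\ge 4$ (if there are any), or, if $G$ has no chains of length $\ge 4$, the $3$-chain (if $G$ has one). The core may be empty. Operators. The maps $\Sigma,\Theta,\Phi:\mathbb{Z}\to\mathbb{Z}$ are $\Sigma(x)=|x-4|+2$, $\Theta(x)=x-1$, $\Phi(x)=|x-4|$. Exponents denote iteration. *)

theory Defs
  imports Main "HOL-Library.Multiset"
begin

datatype component = Chain nat | Loop nat

fun len :: "component \<Rightarrow> nat" where
  "len (Chain n) = n"
| "len (Loop n) = n"

fun is_chain :: "component \<Rightarrow> bool" where
  "is_chain (Chain n) = True"
| "is_chain (Loop n) = False"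

fun is_loop :: "component \<Rightarrow> bool" where
  "is_loop (Chain n) = False"
| "is_loop (Loop n) = True"

fun valid_component :: "component \<Rightarrow> bool" where
  "valid_component (Chain n) \<longleftrightarrow> 3 \<le> n"
| "valid_component (Loop n) \<longleftrightarrow> 4 \<le> n \<and> even n"

type_synonym position = "component multiset"

definition valid_position :: "position \<Rightarrow> bool" where
  "valid_position G \<longleftrightarrow> (\<forall>C\<in>#G. valid_component C)"

text \<open>The number of unclaimed boxes; the library constant \<open>size\<close> counts the components.\<close>

definition boxes :: "position \<Rightarrow> nat" where
  "boxes G = (\<Sum>C\<in>#G. len C)"

text \<open>The number of boxes the controller leaves to the opener when keeping control.\<close>

fun left_over :: "component \<Rightarrow> int" where
  "left_over (Chain n) = 2"
| "left_over (Loop n) = 4"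

text \<open>
  The controller's margin once \<open>C\<close> has been opened, where \<open>x\<close> is the value of the
  remaining position. The first alternative keeps control: the controller takes all but
  \<open>left_over C\<close> boxes, the opener takes the others and opens again. The second one gives
  up control: the controller takes all of \<open>C\<close> and is the opener from then on.
\<close>

definition opened_margin :: "component \<Rightarrow> int \<Rightarrow> int" where
  "opened_margin C x = max (int (len C) - 2 * left_over C + x) (int (len C) - x)"

function value_of :: "position \<Rightarrow> int" where
  "value_of G =
    (if G = {#} then 0
     else Min ((\<lambda>C. opened_margin C (value_of (G - {#C#}))) ` set_mset G))"
  by pat_completeness auto
termination
  by (relation "measure size") (auto simp: size_Diff1_less)

declare value_of.simps [simp del]

definition value_opened :: "position \<Rightarrow> component \<Rightarrow> int" where
  "value_opened G C = opened_margin C (value_of (G - {#C#}))"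

lemma value_of_empty: "value_of {#} = 0"
  by (simp add: value_of.simps)

lemma value_of_nonempty:
  "G \<noteq> {#} \<Longrightarrow> value_of G = Min (value_opened G ` set_mset G)"
  by (subst value_of.simps) (simp add: value_opened_def)

lemma value_opened_eq:
  "value_opened G C =
    (int (len C) - left_over C) + \<bar>value_of (G - {#C#}) - left_over C\<bar>"
  by (simp add: value_opened_def opened_margin_def max_def abs_if)

definition terminal_bonus :: "position \<Rightarrow> int" where
  "terminal_bonus G =
    (if G = {#} then 0
     else if \<forall>C\<in>#G. is_loop C then 8
     else if (\<exists>C\<in>#G. is_loop C) \<and> Chain 3 \<in># G \<and> (\<forall>C\<in>#G. is_loop C \<or> C = Chain 3) then 6
     else 4)"

definition controlled_value :: "position \<Rightarrow> int" where
  "controlled_value G =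
    int (boxes G) - 4 * int (size (filter_mset is_chain G))
      - 8 * int (size (filter_mset is_loop G)) + terminal_bonus G"

text \<open>Only meaningful for positions with at most one 3-chain.\<close>

definition core :: "position \<Rightarrow> position" where
  "core G =
    filter_mset (\<lambda>C. is_loop C \<and> 8 \<le> len C) G
    + (if \<exists>C\<in>#G. is_chain C \<and> 4 \<le> len C
       then filter_mset (\<lambda>C. is_chain C \<and> 4 \<le> len C) G
       else filter_mset (\<lambda>C. C = Chain 3) G)"

definition Sigma_op :: "int \<Rightarrow> int" where
  "Sigma_op x = \<bar>x - 4\<bar> + 2"

definition Theta_op :: "int \<Rightarrow> int" where
  "Theta_op x = x - 1"

definition Phi_op :: "int \<Rightarrow> int" where
  "Phi_op x = \<bar>x - 4\<bar>"

end

theory Submission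
  imports Defs
begin

text \<open>
  The proof is an induction on the number of components. A controller who keeps control until
  it is time to harvest the terminal bonus obtains \<open>c\<close>, so
  \<open>v \<ge> c\<close> always (\<open>value_ge_controlled\<close>). If \<open>c \<ge> 2\<close>, the opener has,
  apart from a few small endings, a move after which the rest is worth at least as much as the
  boxes left over by keeping control. The controller then does best to keep it, and \<open>v = c\<close>
  (\<open>value_of_large\<close>). What remains is the case \<open>c < 2\<close>, where all
  values are small.

  If \<open>c = 0\<close> and there is a 4-loop, opening it usually leaves a rest of value exactly 4, so
  that both options of the controller give 0 (\<open>value_of_vanishing\<close>). The position
  \<open>4\<^sub>\<ell> + 3 + 3\<close> is exceptional because losing its only loop changes the terminal
  bonus.

  In the positions with no 3-chain, or with one 3-chain and size 3 modulo 4 (called tame here),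
  opening a 4-loop turns the value \<open>x\<close> of the rest into \<open>\<Phi>(x)\<close>, opening a 6-loop turns
  it into \<open>\<Sigma>(x)\<close>, and opening the 3-chain turns \<open>x \<ge> 2\<close> into \<open>\<Theta>(x)\<close>. The
  formula applies these operators to the core in the order in which the opener should play, so
  that, with one exceptional shape, it is the margin of an available move. That nothing is
  cheaper follows because the formula gives a number between 0 and 4: parity excludes most
  moves, and a congruence modulo 4 the others (\<open>value_of_tame\<close>).

  In all other positions the opener can bring the margin down to 1 or 2, nearly always by
  opening a 3-chain. The parity of the value is that of the size, so the only thing to exclude
  is the value 0. It would need a 4-loop whose removal leaves a rest of value 4
  (\<open>value_of_remaining\<close>).

  Two facts make the case distinctions arithmetical. The controlled value is a sum over the
  components plus a bonus that depends only on which kinds of components occur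
  (\<open>controlled_value_eq\<close>, \<open>terminal_bonus_eq\<close>); and the formula for the tame
  positions can be rewritten in terms of \<open>c\<close> instead of the core (\<open>core_formula_eq\<close>).
\<close>

(* Multiplicities of components are treated as numbers and not turned into membership. *)
declare count_greater_zero_iff [simp del] count_greater_eq_Suc_zero_iff [simp del]
  count_greater_eq_one_iff [simp del]

section \<open>Numerical operators\<close>

lemma Sigma_pow_Suc: "(Sigma_op ^^ Suc s) x = \<bar>(Sigma_op ^^ s) x - 4\<bar> + 2"
  by (simp add: Sigma_op_def[of "(Sigma_op ^^ s) x"])

lemma Phi_pow_Suc: "(Phi_op ^^ Suc f) y = \<bar>(Phi_op ^^ f) y - 4\<bar>"
  by (simp add: Phi_op_def[of "(Phi_op ^^ f) y"])

text \<open>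
  From 4 on the operators are translations: \<open>\<Sigma>\<close> subtracts 2 and \<open>\<Phi>\<close> subtracts 4.
  The interval \<open>{2..4}\<close> is mapped into itself by \<open>\<Sigma>\<close>, the interval \<open>{0..4}\<close>
  by \<open>\<Phi>\<close>, and neither is jumped over on the way down.
\<close>

lemma Sigma_pow_linear: "x - 2 * int s \<ge> 2 \<Longrightarrow> (Sigma_op ^^ s) x = x - 2 * int s"
  by (induction s) (auto simp: Sigma_pow_Suc simp del: funpow.simps(2))

lemma Sigma_pow_ge: "x \<ge> 2 \<Longrightarrow> (Sigma_op ^^ s) x \<ge> 2"
  by (induction s) (auto simp: Sigma_pow_Suc simp del: funpow.simps(2))

lemma Sigma_pow_trapped:
  assumes "x \<ge> 2" "x - 2 * int s < 2"
  shows "(Sigma_op ^^ s) x \<le> 4"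
  using assms
proof (induction s)
  case (Suc s)
  show ?case
  proof (cases "x - 2 * int s < 2")
    case True
    then show ?thesis
      using Suc.IH[OF Suc.prems(1)] Sigma_pow_ge[OF Suc.prems(1), of s] by (simp add: Sigma_pow_Suc del: funpow.simps(2))
  next
    case False
    then show ?thesis
      using Sigma_pow_linear[of x s] Suc.prems by (simp add: Sigma_pow_Suc del: funpow.simps(2))
  qed
qed simp

lemma Sigma_pow_even: "even ((Sigma_op ^^ s) x) \<longleftrightarrow> even x"
  by (induction s) (auto simp: Sigma_pow_Suc simp del: funpow.simps(2))

text \<open>
  Reflection at 4 preserves an even number modulo 4, so on even arguments the translation
  describes \<open>\<Sigma>\<close> modulo 4 everywhere.
\<close>

lemma Sigma_pow_mod4:
  assumes "even x"
  shows "4 dvd (Sigma_op ^^ s) x - (x - 2 * int s)"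
proof (induction s)
  case (Suc s)
  define y where "y = (Sigma_op ^^ s) x"
  have "even y" using assms by (simp add: y_def Sigma_pow_even)
  moreover have "4 dvd y - (x - 2 * int s)" using Suc by (simp add: y_def)
  ultimately have "4 dvd (\<bar>y - 4\<bar> + 2) - (x - 2 * int s - 2)" by presburger
  then show ?case by (simp add: Sigma_pow_Suc del: funpow.simps(2) add: y_def[symmetric] algebra_simps)
qed simp

lemma Phi_pow_linear: "y \<ge> 4 * int f \<Longrightarrow> (Phi_op ^^ f) y = y - 4 * int f"
  by (induction f) (auto simp: Phi_pow_Suc simp del: funpow.simps(2))

lemma Phi_pow_small: "0 \<le> y \<Longrightarrow> y \<le> 4 \<Longrightarrow> (Phi_op ^^ f) y \<in> {0..4}"
  by (induction f) (auto simp: Phi_pow_Suc simp del: funpow.simps(2))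

lemma Phi_pow_trapped:
  assumes "0 \<le> y" "y < 4 * int f"
  shows "(Phi_op ^^ f) y \<in> {0..4}"
  using assms
proof (induction f)
  case (Suc f)
  show ?case
  proof (cases "y < 4 * int f")
    case True
    then show ?thesis using Suc by (auto simp: Phi_pow_Suc simp del: funpow.simps(2))
  next
    case False
    then show ?thesis
      using Phi_pow_linear[of f y] Suc.prems by (simp add: Phi_pow_Suc del: funpow.simps(2))
  qed
qed simp

lemma Phi_pow_even: "even ((Phi_op ^^ f) y) \<longleftrightarrow> even y"
  by (induction f) (auto simp: Phi_pow_Suc simp del: funpow.simps(2))

lemma Phi_pow_mod4:
  assumes "even y"
  shows "4 dvd (Phi_op ^^ f) y - y"
proof (induction f)
  case (Suc f)
  define z where "z = (Phi_op ^^ f) y"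
  have "even z" using assms by (simp add: z_def Phi_pow_even)
  moreover have "4 dvd z - y" using Suc by (simp add: z_def)
  ultimately have "4 dvd \<bar>z - 4\<bar> - y" by presburger
  then show ?case by (simp add: Phi_pow_Suc z_def del: funpow.simps(2))
qed simp

text \<open>
  Both operators depend only on the distance from 4. This absorbs the jump of the terminal bonus
  between a position and its core, where 0 meets 8 or 3 meets 5.
\<close>

lemma Phi_Sigma_reflect:
  assumes "\<bar>x - 4\<bar> = \<bar>y - 4\<bar>" and "0 < f + s"
  shows "(Phi_op ^^ f) ((Sigma_op ^^ s) x) = (Phi_op ^^ f) ((Sigma_op ^^ s) y)"
proof (cases s)
  case 0
  then obtain f' where "f = Suc f'" using assms(2) by (cases f) auto
  then show ?thesis using 0 assms(1) by (simp add: funpow_Suc_right Phi_op_def del: funpow.simps(2))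
next
  case (Suc s')
  then show ?thesis using assms(1) by (simp add: funpow_Suc_right Sigma_op_def del: funpow.simps(2))
qed

section \<open>Statistics of a position\<close>

abbreviation threes :: "position \<Rightarrow> nat" where "threes G \<equiv> count G (Chain 3)"
abbreviation fours :: "position \<Rightarrow> nat" where "fours G \<equiv> count G (Loop 4)"
abbreviation sixes :: "position \<Rightarrow> nat" where "sixes G \<equiv> count G (Loop 6)"

definition has_loop :: "position \<Rightarrow> bool" where
  "has_loop G \<longleftrightarrow> (\<exists>C\<in>#G. is_loop C)"

definition has_long :: "position \<Rightarrow> bool" where
  "has_long G \<longleftrightarrow> (\<exists>C\<in>#G. is_chain C \<and> 4 \<le> len C)"

text \<open>
  The margin of a controller who keeps control at every component, the last one included. The
  terminal bonus corrects for the end of the game.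
\<close>

definition keep_margin :: "position \<Rightarrow> int" where
  "keep_margin G = (\<Sum>C\<in>#G. int (len C) - 2 * left_over C)"

lemma boxes_simps [simp]:
  "boxes {#} = 0" "boxes (add_mset C G) = len C + boxes G"
  by (simp_all add: boxes_def)

lemma has_loop_simps [simp]:
  "\<not> has_loop {#}" "has_loop (add_mset C G) \<longleftrightarrow> is_loop C \<or> has_loop G"
  by (simp_all add: has_loop_def)

lemma has_long_simps [simp]:
  "\<not> has_long {#}" "has_long (add_mset C G) \<longleftrightarrow> is_chain C \<and> 4 \<le> len C \<or> has_long G"
  by (simp_all add: has_long_def)

lemma keep_margin_simps [simp]:
  "keep_margin {#} = 0"
  "keep_margin (add_mset C G) = int (len C) - 2 * left_over C + keep_margin G"
  "keep_margin (G + H) = keep_margin G + keep_margin H"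
  "keep_margin (replicate_mset n C) = int n * (int (len C) - 2 * left_over C)"
  by (simp_all add: keep_margin_def)

lemma valid_simps [simp]:
  "valid_position {#}"
  "valid_position (add_mset C G) \<longleftrightarrow> valid_component C \<and> valid_position G"
  by (auto simp: valid_position_def)

lemma left_over_pos: "left_over C = 2 \<or> left_over C = 4"
  by (cases C) auto

lemma controlled_value_eq: "controlled_value G = keep_margin G + terminal_bonus G"
proof -
  have "keep_margin G = int (boxes G) - 4 * int (size (filter_mset is_chain G))
      - 8 * int (size (filter_mset is_loop G))"
  proof (induction G)
    case (add C G)
    then show ?case by (cases C) auto
  qed simp
  then show ?thesis by (simp add: controlled_value_def)
qed

lemma terminal_bonus_empty [simp]: "terminal_bonus {#} = 0"
  by (simp add: terminal_bonus_def)

text \<open>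
  Valid components are loops, 3-chains or long chains, so the bonus is determined by which of
  these three kinds occur.
\<close>

lemma terminal_bonus_eq:
  assumes "valid_position G" "G \<noteq> {#}"
  shows "terminal_bonus G =
    (if has_long G then 4 else if threes G = 0 then 8 else if has_loop G then 6 else 4)"
proof -
  have kind: "is_loop C \<or> C = Chain 3 \<or> is_chain C \<and> 4 \<le> len C" if "C \<in># G" for C
    using that assms(1) by (cases C) (force simp: valid_position_def)+
  have long: "\<not> is_loop C \<and> C \<noteq> Chain 3" if "is_chain C \<and> 4 \<le> len C" for C
    using that by (cases C) auto
  have three: "threes G = 0 \<longleftrightarrow> Chain 3 \<notin># G" by (simp add: not_in_iff)
  have loops: "(\<forall>C\<in>#G. is_loop C) \<longleftrightarrow> \<not> has_long G \<and> Chain 3 \<notin># G"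
    using kind long unfolding has_long_def by (metis is_loop.simps(1))
  have threes: "(\<forall>C\<in>#G. is_loop C \<or> C = Chain 3) \<longleftrightarrow> \<not> has_long G"
    using kind long unfolding has_long_def by blast
  show ?thesis
    unfolding terminal_bonus_def loops threes three has_loop_def[symmetric] using assms(2) by auto
qed

lemma controlled_value_mod4:
  "int (boxes G) mod 4 = (controlled_value G - terminal_bonus G) mod 4"
  unfolding controlled_value_def by presburger

text \<open>
  Only 3-chains, 6-loops and 4-loops contribute negatively, namely by 1, 2 and 4.
\<close>

lemma keep_margin_ge:
  assumes "valid_position G"
  shows "keep_margin G + int (threes G) + 2 * int (sixes G) + 4 * int (fours G) \<ge> 0"
  using assms
proof (induction G)
  case (add C G)
  have "int (len C) - 2 * left_over C
      + int (if C = Chain 3 then 1 else 0) + 2 * int (if C = Loop 6 then 1 else 0)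
      + 4 * int (if C = Loop 4 then 1 else 0) \<ge> 0"
  proof (cases C)
    case (Loop n)
    with add.prems have "4 \<le> n" "even n" by auto
    then have "n = 4 \<or> n = 6 \<or> 8 \<le> n" by presburger
    then show ?thesis using Loop by auto
  qed (use add.prems in auto)
  then show ?case using add by (auto split: if_splits)
qed simp

section \<open>The value as a minimum over openings\<close>

lemma value_opened_add:
  "value_opened (add_mset C H) C = int (len C) - left_over C + \<bar>value_of H - left_over C\<bar>"
  by (simp add: value_opened_eq)

lemma value_le_opened:
  "value_of (add_mset C H) \<le> int (len C) - left_over C + \<bar>value_of H - left_over C\<bar>"
  unfolding value_opened_add[symmetric] by (subst value_of_nonempty) auto

lemma value_ge_opened:
  assumes "G \<noteq> {#}"
    and "\<And>C H. G = add_mset C H \<Longrightarrow>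
      m \<le> int (len C) - left_over C + \<bar>value_of H - left_over C\<bar>"
  shows "m \<le> value_of G"
proof -
  have "m \<le> value_opened G C" if "C \<in># G" for C
    using assms(2)[of C "G - {#C#}"] that by (simp add: value_opened_eq)
  then show ?thesis using assms(1) by (simp add: value_of_nonempty)
qed

lemma value_obtain:
  assumes "G \<noteq> {#}"
  obtains C H where "G = add_mset C H"
    "value_of G = int (len C) - left_over C + \<bar>value_of H - left_over C\<bar>"
proof -
  have "value_of G \<in> value_opened G ` set_mset G"
    using assms by (simp add: value_of_nonempty del: Min_in) (rule Min_in; simp)
  then obtain C where C: "C \<in># G" "value_of G = value_opened G C" by auto
  show thesis
    by (rule that[of C "G - {#C#}"]) (use C in \<open>simp_all add: value_opened_eq\<close>)
qed

text \<open>
  All boxes are captured in the end, so the margin has the parity of their number.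
\<close>

lemma value_parity: "even (value_of G) \<longleftrightarrow> even (boxes G)"
proof (induction G rule: measure_induct_rule[where f = size])
  case (less G)
  show ?case
  proof (cases "G = {#}")
    case False
    then obtain C H where CH: "G = add_mset C H"
      "value_of G = int (len C) - left_over C + \<bar>value_of H - left_over C\<bar>"
      by (rule value_obtain)
    have "even (value_of H) \<longleftrightarrow> even (boxes H)" using less CH(1) by simp
    then show ?thesis using CH left_over_pos[of C] by auto
  qed (simp add: value_of_empty)
qed

lemma value_nonneg:
  assumes "valid_position G"
  shows "value_of G \<ge> 0"
proof (cases "G = {#}")
  case False
  then obtain C H where CH: "G = add_mset C H"
    "value_of G = int (len C) - left_over C + \<bar>value_of H - left_over C\<bar>"
    by (rule value_obtain)
  have "int (len C) \<ge> left_over C" using assms CH(1) by (cases C) auto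
  then show ?thesis using CH by simp
qed (simp add: value_of_empty)

section \<open>Staying in control\<close>

text \<open>
  From the values 3, 2, 1, 2, 1, ... only the upper bound is of interest: it bounds what the
  controller loses by giving up control in front of a collection of 3-chains.
\<close>

lemma value_threes_le: "value_of (replicate_mset n (Chain 3)) \<in> {0..3}"
proof (induction n)
  case (Suc n)
  then show ?case
    using value_le_opened[of "Chain 3" "replicate_mset n (Chain 3)"]
      value_nonneg[of "replicate_mset (Suc n) (Chain 3)"]
    by (auto simp: valid_position_def)
qed (simp add: value_of_empty)

lemma only_threes:
  assumes "valid_position G" "\<not> has_long G" "\<not> has_loop G"
  shows "G = replicate_mset (threes G) (Chain 3)"
proof (rule multiset_eqI)
  fix C
  have "C = Chain 3" if "C \<in># G"
    using assms that by (cases C) (force simp: valid_position_def has_long_def has_loop_def)+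
  then show "count G C = count (replicate_mset (threes G) (Chain 3)) C"
    by (metis count_eq_zero_iff count_replicate_mset)
qed

text \<open>
  Keeping control realizes the sum of the single margins, and usually the terminal bonus of the
  rest is at least that of the whole. The exceptions are the last component, and a loop
  opened in front of 3-chains alone; there the controller takes everything and gives up control.
\<close>

lemma value_ge_controlled:
  assumes "valid_position G"
  shows "controlled_value G \<le> value_of G"
  using assms
proof (induction G rule: measure_induct_rule[where f = size])
  case (less G)
  show ?case
  proof (cases "G = {#}")
    case False
    then show ?thesis
    proof (rule value_ge_opened)
      fix C H assume G: "G = add_mset C H"
      have valid: "valid_position H" "valid_component C" using less.prems G by auto
      have IH: "controlled_value H \<le> value_of H" using less.IH[of H] valid G by simp
      note bonus = terminal_bonus_eq[OF less.prems False]
      consider (empty) "H = {#}" | (threes) "H \<noteq> {#}" "is_loop C" "\<not> has_long H" "\<not> has_loop H"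
        | (other) "H \<noteq> {#}" "is_chain C \<or> has_long H \<or> has_loop H"
        by (cases C) auto
      then show "controlled_value G \<le> int (len C) - left_over C + \<bar>value_of H - left_over C\<bar>"
      proof cases
        case empty
        then show ?thesis using bonus G valid
          by (cases C) (auto simp: controlled_value_eq value_of_empty)
      next
        case threes
        \<comment> \<open>The bonus of the rest is 4 and that of the whole is 6.\<close>
        have H: "H = replicate_mset (threes H) (Chain 3)"
          using only_threes threes valid by blast
        obtain n where C: "C = Loop n" using threes by (cases C) auto
        have "threes H \<noteq> 0" using H threes(1) by (metis replicate_mset_0)
        then have t: "int (threes H) \<ge> 1" by linarith
        have "terminal_bonus G \<le> 6"
          using bonus G C threes \<open>threes H \<noteq> 0\<close> by simp
        have "value_of H \<le> 3" using value_threes_le[of "threes H"] H by simp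
        moreover have "keep_margin H = - int (threes H)" by (subst H) simp
        moreover have "controlled_value G = int n - 8 + keep_margin H + terminal_bonus G"
          using G C by (simp add: controlled_value_eq)
        moreover have "int (len C) - left_over C = int n - 4" "left_over C = 4" using C by simp_all
        ultimately show ?thesis using t \<open>terminal_bonus G \<le> 6\<close> by linarith
      next
        case other
        have "terminal_bonus G \<le> terminal_bonus H"
          using bonus terminal_bonus_eq[OF valid(1) other(1)] other(2) G valid
          by (cases C) auto
        then show ?thesis using IH G by (simp add: controlled_value_eq)
      qed
    qed
  qed (simp add: controlled_value_eq value_of_empty)
qed

section \<open>The core formula\<close>

text \<open>
  The right-hand side of the third part of the theorem.
\<close>

definition core_formula :: "position \<Rightarrow> int" where
  "core_formula G = (Phi_op ^^ fours G) ((Theta_op ^^ count (G - core G) (Chain 3))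
     ((Sigma_op ^^ sixes G) (controlled_value (core G))))"

text \<open>
  For a position with at most one 3-chain this is the exponent of \<open>\<Theta>\<close>: a long chain expels
  the 3-chain from the core.
\<close>

definition surplus_threes :: "position \<Rightarrow> nat" where
  "surplus_threes G = (if has_long G then threes G else 0)"

lemma core_eq:
  "core G = filter_mset (\<lambda>C. is_loop C \<and> 8 \<le> len C) G
    + (if has_long G then filter_mset (\<lambda>C. is_chain C \<and> 4 \<le> len C) G
       else filter_mset (\<lambda>C. C = Chain 3) G)"
  by (simp only: core_def has_long_def)

lemma count_off_core: "count (G - core G) (Chain 3) = surplus_threes G"
  by (auto simp: core_eq surplus_threes_def)

lemma core_decomposition:
  assumes "valid_position G"
  shows "G = core G + replicate_mset (surplus_threes G) (Chain 3)
    + replicate_mset (fours G) (Loop 4) + replicate_mset (sixes G) (Loop 6)"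
proof (rule multiset_eqI)
  fix C
  have absent: "count G C = 0" if "\<not> valid_component C"
    using that assms by (auto simp: valid_position_def not_in_iff)
  show "count G C = count (core G + replicate_mset (surplus_threes G) (Chain 3)
    + replicate_mset (fours G) (Loop 4) + replicate_mset (sixes G) (Loop 6)) C"
  proof (cases C)
    case (Chain n)
    consider "n < 3" | "n = 3" | "4 \<le> n" by linarith
    then show ?thesis
      using absent Chain
      by cases (auto simp: core_eq surplus_threes_def count_eq_zero_iff
          has_long_def)
  next
    case (Loop n)
    consider "n < 4 \<or> odd n" | "n = 4" | "n = 6" | "8 \<le> n" by atomize_elim presburger
    then show ?thesis
      using absent Loop by cases (auto simp: core_eq)
  qed
qed

text \<open>
  Removing 3-chains, 4-loops and 6-loops changes the sum of margins by 1, 4 and 2 each, so \<open>c\<close> of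
  the core can be recovered from \<open>c\<close> of the position, unless the terminal bonus
  changes. That happens in two ways only: the core is empty and the position consists of small
  loops (0 instead of 8), or the core is a single 3-chain and all loops are small (3 instead of
  5). In both cases the two numbers have the same distance from 4, and there is an
  operator that does not distinguish them.
\<close>

lemma core_formula_eq:
  assumes "valid_position G" "G \<noteq> {#}" "threes G \<le> 1"
  shows "core_formula G = (Phi_op ^^ fours G)
    ((Sigma_op ^^ sixes G) (controlled_value G + int (surplus_threes G)
        + 2 * int (sixes G) + 4 * int (fours G)) - int (surplus_threes G))"
proof -
  let ?t = "surplus_threes G" and ?f = "fours G" and ?s = "sixes G"
  define b where "b = controlled_value G + int ?t + 2 * int ?s + 4 * int ?f"
  note dec = core_decomposition[OF assms(1)]
  have keep: "keep_margin G = keep_margin (core G) - int ?t - 4 * int ?f - 2 * int ?s"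
    by (subst dec) simp
  have core_valid: "valid_position (core G)"
    using assms(1) by (auto simp: core_eq valid_position_def)
  have core_long: "has_long (core G) \<longleftrightarrow> has_long G"
    by (auto simp: core_eq has_long_def split: if_splits)
  have core_threes: "threes (core G) = (if has_long G then 0 else threes G)"
    by (simp add: core_eq)
  have core_loop: "has_loop (core G) \<Longrightarrow> has_loop G"
    by (auto simp: core_eq has_loop_def split: if_splits)
  have Theta: "(Theta_op ^^ ?t) x = x - int ?t" for x
    using assms(3) by (cases "?t = 0"; cases "?t = 1") (auto simp: Theta_op_def surplus_threes_def)
  note bonus = terminal_bonus_eq[OF assms(1,2)]
  have "controlled_value (core G) = b \<or> 0 < ?f + ?s \<and> ?t = 0 \<and>
      \<bar>controlled_value (core G) - 4\<bar> = \<bar>b - 4\<bar>"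
  proof (cases "terminal_bonus (core G) = terminal_bonus G")
    case True
    then show ?thesis using keep by (simp add: controlled_value_eq b_def)
  next
    case False
    have no_long: "\<not> has_long G"
      using False bonus terminal_bonus_eq[OF core_valid] core_long by force
    then have t0: "?t = 0" by (simp add: surplus_threes_def)
    have fs: "0 < ?f + ?s"
    proof (rule ccontr)
      assume "\<not> 0 < ?f + ?s"
      then have "G = core G" using dec t0 by simp
      then show False using False by simp
    qed
    show ?thesis
    proof (cases "threes G = 0")
      case True
      then have "core G = {#}"
        using False bonus terminal_bonus_eq[OF core_valid] core_long core_threes no_long by force
      moreover have "terminal_bonus G = 8" using bonus True no_long by simp
      ultimately show ?thesis
        using keep t0 fs by (simp add: controlled_value_eq b_def)
    next
      case nz: False
      then have one: "threes G = 1" using assms(3) by simp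
      have ne: "core G \<noteq> {#}" using core_threes no_long one by (metis count_empty zero_neq_one)
      have nl: "\<not> has_loop (core G)" and l: "has_loop G"
        using False bonus terminal_bonus_eq[OF core_valid ne] core_long core_threes core_loop
          no_long one by (auto split: if_splits)
      have "core G = {#Chain 3#}"
        using only_threes[OF core_valid _ nl] core_long core_threes no_long one by simp
      moreover have "terminal_bonus (core G) = 4"
        using terminal_bonus_eq[OF core_valid ne] core_long core_threes no_long one nl by simp
      moreover have "terminal_bonus G = 6" using bonus one no_long l by simp
      ultimately show ?thesis
        using keep t0 fs by (simp add: controlled_value_eq b_def)
    qed
  qed
  then have "(Phi_op ^^ ?f) ((Sigma_op ^^ ?s) (controlled_value (core G)) - int ?t)
      = (Phi_op ^^ ?f) ((Sigma_op ^^ ?s) b - int ?t)"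
    using Phi_Sigma_reflect[of "controlled_value (core G)" b ?f ?s] by auto
  then show ?thesis by (simp add: core_formula_def count_off_core Theta b_def del: count_diff)
qed

text \<open>
  The hypothesis of the third part of the theorem.
\<close>

definition tame :: "position \<Rightarrow> bool" where
  "tame G \<longleftrightarrow> threes G = 0 \<or> threes G = 1 \<and> boxes G mod 4 = 3"

text \<open>
  Small loops do not touch the core, so opening one of them matches the outermost operator.
\<close>

lemma core_formula_Loop4:
  "core_formula (add_mset (Loop 4) H) = \<bar>core_formula H - 4\<bar>"
proof -
  have "core (add_mset (Loop 4) H) = core H" by (simp add: core_eq)
  then show ?thesis
    by (simp add: core_formula_def count_off_core surplus_threes_def Phi_pow_Suc del: funpow.simps(2))
qed

lemma core_formula_Loop6:
  assumes "threes H = 0" "fours H = 0"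
  shows "core_formula (add_mset (Loop 6) H) = \<bar>core_formula H - 4\<bar> + 2"
proof -
  have "core (add_mset (Loop 6) H) = core H" by (simp add: core_eq)
  then show ?thesis using assms
    by (simp add: core_formula_def count_off_core surplus_threes_def Sigma_pow_Suc del: funpow.simps(2))
qed

lemma core_formula_base_ge:
  assumes "valid_position G" "G \<noteq> {#}" "threes G \<le> 1"
  shows "controlled_value G + int (surplus_threes G) + 2 * int (sixes G) + 4 * int (fours G) \<ge> 3"
    and "threes G = surplus_threes G \<Longrightarrow>
      controlled_value G + int (surplus_threes G) + 2 * int (sixes G) + 4 * int (fours G) \<ge> 4"
  using keep_margin_ge[OF assms(1)] terminal_bonus_eq[OF assms(1,2)] assms(3)
  by (auto simp: controlled_value_eq surplus_threes_def split: if_splits)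

lemma terminal_bonus_even: "even (terminal_bonus G)"
  by (simp add: terminal_bonus_def)

lemma controlled_value_even: "even (controlled_value G) \<longleftrightarrow> even (boxes G)"
  using controlled_value_mod4[of G] terminal_bonus_even[of G] by presburger

lemma surplus_threes_le: "surplus_threes G \<le> threes G"
  by (simp add: surplus_threes_def)

lemma tame_threes_le: "tame G \<Longrightarrow> threes G \<le> 1"
  by (auto simp: tame_def)

text \<open>
  Here all the arguments stay in the range where the operators are translations. This covers the
  overlap of the third part of the theorem with the first two.
\<close>

lemma core_formula_large:
  assumes "valid_position G" "G \<noteq> {#}" "threes G \<le> 1"
    and "controlled_value G \<ge> 2 \<or> controlled_value G = 0 \<and> 0 < fours G"
  shows "core_formula G = controlled_value G"
proof -
  let ?t = "int (surplus_threes G)" and ?f = "fours G" and ?s = "sixes G"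
  let ?c = "controlled_value G"
  have "?c + ?t + 4 * int ?f \<ge> 2" using assms(4) by auto
  then have "(Sigma_op ^^ ?s) (?c + ?t + 2 * int ?s + 4 * int ?f) = ?c + ?t + 4 * int ?f"
    using Sigma_pow_linear[of "?c + ?t + 2 * int ?s + 4 * int ?f" ?s] by simp
  then show ?thesis
    using core_formula_eq[OF assms(1-3)] Phi_pow_linear[of ?f "?c + 4 * int ?f"] assms(4)
    by auto
qed

lemma core_formula_small:
  assumes "valid_position G" "G \<noteq> {#}" "threes G \<le> 1" and "controlled_value G < 2"
  shows "core_formula G \<in> {0..4}"
proof -
  let ?t = "int (surplus_threes G)" and ?f = "fours G" and ?s = "sixes G"
  let ?c = "controlled_value G"
  let ?b = "?c + ?t + 2 * int ?s + 4 * int ?f"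
  have b: "?b \<ge> 3" by (rule core_formula_base_ge(1)[OF assms(1-3)])
  have t: "?t \<le> 1" "?t \<ge> 0" using surplus_threes_le[of G] assms(3) by linarith+
  have eq: "core_formula G = (Phi_op ^^ ?f) ((Sigma_op ^^ ?s) ?b - ?t)"
    by (rule core_formula_eq[OF assms(1-3)])
  show ?thesis
  proof (cases "?b - 2 * int ?s \<ge> 2")
    case True
    then have y: "(Sigma_op ^^ ?s) ?b - ?t = ?c + 4 * int ?f"
      using Sigma_pow_linear[of ?b ?s] by simp
    show ?thesis
    proof (cases "?c \<ge> 0")
      case True
      then show ?thesis using eq y Phi_pow_linear[of ?f "?c + 4 * int ?f"] assms(4) by simp
    next
      case False
      then show ?thesis
        using eq y Phi_pow_trapped[of "?c + 4 * int ?f" ?f] True t by simp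
    qed
  next
    case False
    have "(Sigma_op ^^ ?s) ?b \<le> 4" by (rule Sigma_pow_trapped) (use b False in linarith)+
    moreover have "(Sigma_op ^^ ?s) ?b \<ge> 2" by (rule Sigma_pow_ge) (use b in linarith)
    ultimately show ?thesis
      using eq Phi_pow_small[of "(Sigma_op ^^ ?s) ?b - ?t" ?f] t by simp
  qed
qed

lemma core_formula_even:
  assumes "valid_position G" "G \<noteq> {#}" "threes G \<le> 1"
  shows "even (core_formula G) \<longleftrightarrow> even (boxes G)"
  using core_formula_eq[OF assms]
  by (simp add: Phi_pow_even Sigma_pow_even controlled_value_even) blast

text \<open>
  This congruence is what separates the values 2 and 4 (or 0) of even positions without
  3-chains.
\<close>

lemma core_formula_mod4:
  assumes "valid_position G" "threes G = 0" "even (boxes G)"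
  shows "4 dvd core_formula G - int (boxes G)"
proof (cases "G = {#}")
  case True
  then show ?thesis by (simp add: core_formula_def core_eq controlled_value_eq)
next
  case False
  let ?f = "fours G" and ?s = "sixes G" and ?c = "controlled_value G"
  let ?b = "?c + 2 * int ?s + 4 * int ?f"
  have t: "surplus_threes G = 0" using surplus_threes_le[of G] assms(2) by simp
  have eq: "core_formula G = (Phi_op ^^ ?f) ((Sigma_op ^^ ?s) ?b)"
    using core_formula_eq[OF assms(1) False] assms(2) t by simp
  have ev: "even ?b" using assms(3) controlled_value_even[of G] by simp
  have "4 dvd (Sigma_op ^^ ?s) ?b - (?b - 2 * int ?s)" by (rule Sigma_pow_mod4[OF ev])
  moreover have "4 dvd core_formula G - (Sigma_op ^^ ?s) ?b"
    unfolding eq using ev by (intro Phi_pow_mod4) (simp add: Sigma_pow_even)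
  moreover have "4 dvd ?c - int (boxes G)"
  proof -
    have "4 dvd terminal_bonus G" using terminal_bonus_eq[OF assms(1) False] assms(2) by simp
    then show ?thesis using controlled_value_mod4[of G] by presburger
  qed
  ultimately show ?thesis by presburger
qed

section \<open>The opener's best moves\<close>

text \<open>
  The hypothesis of the second part of the theorem.
\<close>

definition vanishing :: "position \<Rightarrow> bool" where
  "vanishing G \<longleftrightarrow> controlled_value G = 0 \<and> Loop 4 \<in># G \<and> G \<noteq> {#Loop 4, Chain 3, Chain 3#}"

text \<open>
  The induction hypothesis. It also holds for the empty position, so it is available for every
  rest.
\<close>

definition evaluated :: "position \<Rightarrow> bool" where
  "evaluated G \<longleftrightarrow>
     (controlled_value G \<ge> 2 \<longrightarrow> value_of G = controlled_value G)
   \<and> (vanishing G \<longrightarrow> value_of G = 0)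
   \<and> (tame G \<longrightarrow> value_of G = core_formula G)
   \<and> (\<not> controlled_value G \<ge> 2 \<and> \<not> vanishing G \<and> \<not> tame G \<longrightarrow>
        value_of G = (if odd (boxes G) then 1 else 2))"

lemma evaluated_empty: "evaluated {#}"
  by (simp add: evaluated_def vanishing_def controlled_value_eq value_of_empty core_formula_def
      core_eq tame_def)

text \<open>
  If the rest \<open>H\<close> is worth at least what keeping control costs, the controller keeps it, and
  the controlled values of \<open>H\<close> and \<open>G\<close> differ by the margin of \<open>C\<close>.
\<close>

lemma value_le_keeping:
  assumes "G = add_mset C H" "evaluated H" "terminal_bonus H = terminal_bonus G"
    and "controlled_value H \<ge> left_over C"
  shows "value_of G \<le> controlled_value G"
proof -
  have "value_of H = controlled_value H"
    using assms(2,4) left_over_pos[of C] by (auto simp: evaluated_def)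
  then show ?thesis
    using value_le_opened[of C H] assms by (simp add: controlled_value_eq)
qed

lemma value_le_single:
  assumes "valid_component C"
  shows "value_of {#C#} \<le> controlled_value {#C#}"
  using value_le_opened[of C "{#}"] terminal_bonus_eq[of "{#C#}"] assms
  by (cases C) (auto simp: controlled_value_eq value_of_empty)

lemma no_loop_counts: "\<not> has_loop G \<Longrightarrow> fours G = 0 \<and> sixes G = 0"
  by (auto simp: has_loop_def not_in_iff[symmetric])

lemma nonempty_kinds:
  assumes "valid_position G" "G \<noteq> {#}"
  shows "has_long G \<or> has_loop G \<or> threes G > 0"
  using only_threes[OF assms(1)] assms(2) by (metis gr0I replicate_mset_0)

text \<open>
  The opener's choice has to leave the terminal bonus unchanged and the rest valuable enough. A
  3-chain does this except when it is the only chain beside loops: its removal would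
  raise the bonus from 6 to 8. In that case, and when there are no 3-chains, a smallest kind of
  loop is opened, where all loops of length at least 8 count as one kind. A 4-loop or 6-loop
  raises \<open>c\<close> by its removal; a longer one leaves a rest without small loops. Both give the
  rest a controlled value of at least 4 unless it is empty or a single 3-chain. If there are only
  long chains, any of them will do.
\<close>

lemma value_of_large:
  assumes "valid_position G" "G \<noteq> {#}"
    and IH: "\<And>C H. G = add_mset C H \<Longrightarrow> evaluated H"
    and c: "controlled_value G \<ge> 2"
  shows "value_of G = controlled_value G"
proof (rule antisym[OF _ value_ge_controlled[OF assms(1)]])
  note bonus = terminal_bonus_eq[OF assms(1,2)]
  consider (three) "threes G > 0" "has_long G \<or> threes G \<ge> 2 \<or> \<not> has_loop G"
    | (loop) "has_loop G" "threes G = 0 \<or> threes G = 1 \<and> \<not> has_long G"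
    | (long) "threes G = 0" "\<not> has_loop G"
    by linarith
  then show "value_of G \<le> controlled_value G"
  proof cases
    case three
    then obtain H where G: "G = add_mset (Chain 3) H"
      by (metis count_greater_zero_iff insert_DiffM)
    show ?thesis
    proof (cases "H = {#}")
      case True
      then show ?thesis using G value_le_single[of "Chain 3"] by simp
    next
      case False
      have valid: "valid_position H" using assms(1) G by simp
      have tb: "terminal_bonus H = terminal_bonus G"
        using bonus terminal_bonus_eq[OF valid False] nonempty_kinds[OF valid False] three G
        by (auto split: if_splits)
      show ?thesis
        by (rule value_le_keeping[OF G IH[OF G] tb]) (use tb c G in \<open>simp add: controlled_value_eq\<close>)
    qed
  next
    case loop
    obtain C H where G: "G = add_mset C H" and C: "is_loop C"
      and small: "len C \<le> 6 \<or> fours G = 0 \<and> sixes G = 0"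
    proof -
      consider "Loop 4 \<in># G" | "Loop 6 \<in># G" | "fours G = 0 \<and> sixes G = 0"
        by (metis count_inI)
      then show thesis
      proof cases
        case 1
        show thesis by (rule that[of "Loop 4" "G - {#Loop 4#}"]) (use 1 in auto)
      next
        case 2
        show thesis by (rule that[of "Loop 6" "G - {#Loop 6#}"]) (use 2 in auto)
      next
        case 3
        obtain C where "C \<in># G" "is_loop C" using loop(1) by (auto simp: has_loop_def)
        then show thesis using 3 by (intro that[of C "G - {#C#}"]) auto
      qed
    qed
    have valid: "valid_position H" "valid_component C" using assms(1) G by simp_all
    obtain n where n: "C = Loop n" using C by (cases C) auto
    consider (empty) "H = {#}" | (three) "H \<noteq> {#}" "\<not> has_loop H" "\<not> has_long H"
      | (other) "H \<noteq> {#}" "has_loop H \<or> has_long H"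
      by blast
    then show ?thesis
    proof cases
      case empty
      then show ?thesis using G value_le_single[OF valid(2)] by simp
    next
      case three
      have "threes H = 1"
        using nonempty_kinds[OF valid(1) three(1)] three loop(2) G n by simp
      then have H: "H = {#Chain 3#}" using only_threes[OF valid(1)] three by simp
      have cH: "controlled_value H = 3"
        using terminal_bonus_eq[OF valid(1) three(1)] H by (simp add: controlled_value_eq)
      then have "value_of H = 3" using IH[OF G] by (simp add: evaluated_def)
      moreover have "terminal_bonus G = 6" using bonus G H n by simp
      ultimately show ?thesis
        using value_le_opened[of C H] G n H by (simp add: controlled_value_eq)
    next
      case other
      have tb: "terminal_bonus H = terminal_bonus G"
        using bonus terminal_bonus_eq[OF valid(1) other(1)] other(2) loop G n
        by (auto split: if_splits)
      have "controlled_value H \<ge> 4"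
      proof (cases "len C \<le> 6")
        case True
        then show ?thesis using c tb G n by (simp add: controlled_value_eq)
      next
        case False
        then have "fours H = 0 \<and> sixes H = 0" using small G n by (auto split: if_splits)
        then have "keep_margin H \<ge> - int (threes H)" using keep_margin_ge[OF valid(1)] by simp
        then show ?thesis
          using terminal_bonus_eq[OF valid(1) other(1)] other(2) loop G n
          by (auto simp: controlled_value_eq split: if_splits)
      qed
      then show ?thesis by (intro value_le_keeping[OF G IH[OF G] tb]) (simp add: n)
    qed
  next
    case long
    then have "has_long G" using nonempty_kinds[OF assms(1,2)] by simp
    then obtain n where n: "Chain n \<in># G" "4 \<le> n"
      unfolding has_long_def by (metis is_chain.elims(2) len.simps(1))
    then obtain H where G: "G = add_mset (Chain n) H" by (metis insert_DiffM)
    have valid: "valid_position H" using assms(1) G by simp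
    show ?thesis
    proof (cases "H = {#}")
      case True
      then show ?thesis using G value_le_single[of "Chain n"] n by simp
    next
      case False
      have H: "threes H = 0" "\<not> has_loop H" using long G n by (auto split: if_splits)
      then have "has_long H" using nonempty_kinds[OF valid False] by simp
      then have tb: "terminal_bonus H = 4" "terminal_bonus G = 4"
        using terminal_bonus_eq[OF valid False] bonus G by simp_all
      have "keep_margin H \<ge> 0" using keep_margin_ge[OF valid] no_loop_counts[OF H(2)] H(1) by simp
      then show ?thesis
        using tb by (intro value_le_keeping[OF G IH[OF G]]) (simp_all add: controlled_value_eq)
    qed
  qed
qed

text \<open>
  The rest after opening a 4-loop has controlled value 4, unless the bonus drops with the last
  loop; then \<open>c = 0\<close> forces exactly two 3-chains, which is the excluded position.
\<close>

lemma value_of_vanishing: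
  assumes "valid_position G" "vanishing G" "threes G > 0"
    and IH: "\<And>C H. G = add_mset C H \<Longrightarrow> evaluated H"
  shows "value_of G = 0"
proof -
  obtain H where G: "G = add_mset (Loop 4) H"
    using assms(2) by (metis vanishing_def insert_DiffM)
  have valid: "valid_position H" using assms(1) G by simp
  have ne: "H \<noteq> {#}" "G \<noteq> {#}" using assms(3) G by auto
  note bonus = terminal_bonus_eq[OF assms(1) ne(2)] terminal_bonus_eq[OF valid ne(1)]
  have "has_loop H \<or> has_long H"
  proof (rule ccontr)
    assume no: "\<not> (has_loop H \<or> has_long H)"
    then have H: "H = replicate_mset (threes H) (Chain 3)" using only_threes valid by blast
    have "keep_margin H = - int (threes H)" by (subst H) simp
    then have "threes H = 2"
      using assms(2,3) bonus no G by (simp add: vanishing_def controlled_value_eq)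
    then have "H = {#Chain 3, Chain 3#}" using H by (simp add: numeral_2_eq_2)
    then show False using assms(2) G by (simp add: vanishing_def)
  qed
  then have "terminal_bonus H = terminal_bonus G" using bonus G assms(3) by auto
  then have "controlled_value H = 4"
    using assms(2) G by (simp add: vanishing_def controlled_value_eq)
  then have "value_of H = 4" using IH[OF G] by (simp add: evaluated_def)
  then show ?thesis
    using value_le_opened[of "Loop 4" H] value_nonneg[OF assms(1)] G by simp
qed

text \<open>
  For the upper bound a 4-loop is opened if there is one, otherwise a 6-loop if there is no
  3-chain, otherwise the 3-chain. For the lower bound the value to be beaten is at most 4, so
  a better move would have a margin of at most 2.
\<close>

lemma value_of_tame:
  assumes "valid_position G" "G \<noteq> {#}" "tame G"
    and IH: "\<And>C H. G = add_mset C H \<Longrightarrow> evaluated H"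
    and c: "controlled_value G < 2"
  shows "value_of G = core_formula G"
proof (rule antisym)
  note bonus = terminal_bonus_eq[OF assms(1,2)]
  note t1 = tame_threes_le[OF assms(3)]
  note range = core_formula_small[OF assms(1,2) t1 c]
  note even = core_formula_even[OF assms(1,2) t1]
  have IHtame: "value_of H = core_formula H" if "G = add_mset C H" "tame H" for C H
    using IH[OF that(1)] that(2) by (simp add: evaluated_def)
  have Loop4: "tame H" if "G = add_mset (Loop 4) H" for H
    using assms(3) that by (simp add: tame_def)
  show "value_of G \<le> core_formula G"
  proof (cases "fours G = 0")
    case False
    then obtain H where G: "G = add_mset (Loop 4) H"
      by (metis count_greater_zero_iff gr0I insert_DiffM)
    show ?thesis
      using value_le_opened[of "Loop 4" H] IHtame[OF G Loop4[OF G]] G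
      by (simp add: core_formula_Loop4)
  next
    case f0: True
    show ?thesis
    proof (cases "threes G = 0")
      case True
      have "sixes G \<noteq> 0"
        using core_formula_base_ge(2)[OF assms(1,2) t1] True f0 surplus_threes_le[of G] c by auto
      then obtain H where G: "G = add_mset (Loop 6) H"
        by (metis count_greater_zero_iff gr0I insert_DiffM)
      have H: "threes H = 0" "fours H = 0" using True f0 G by simp_all
      then have "tame H" by (simp add: tame_def)
      then show ?thesis
        using value_le_opened[of "Loop 6" H] IHtame[OF G] G core_formula_Loop6[OF H] by simp
    next
      case False
      then have one: "threes G = 1" and mod: "boxes G mod 4 = 3" using assms(3) by (auto simp: tame_def)
      obtain H where G: "G = add_mset (Chain 3) H"
        using False by (metis count_greater_zero_iff gr0I insert_DiffM)
      have valid: "valid_position H" using assms(1) G by simp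
      have H: "threes H = 0" "fours H = 0" "sixes G = sixes H" "has_long G = has_long H"
        "surplus_threes H = 0"
        using one f0 G by (simp_all add: surplus_threes_def)
      then have vH: "value_of H = core_formula H" using IHtame[OF G] by (simp add: tame_def)
      have ne: "H \<noteq> {#}"
      proof
        assume "H = {#}"
        then show False using c bonus G by (simp add: controlled_value_eq)
      qed
      note bonusH = terminal_bonus_eq[OF valid ne]
      note fH = core_formula_eq[OF valid ne] and fG = core_formula_eq[OF assms(1,2) t1]
      show ?thesis
      proof (cases "has_long G")
        case True
        then have "controlled_value H = controlled_value G + 1"
          using bonus bonusH H(4) G by (simp add: controlled_value_eq)
        then have eq: "core_formula G = core_formula H - 1"
          using fH fG H one f0 True by (simp add: surplus_threes_def add_ac)
        have "core_formula H \<ge> 2"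
          using fH H core_formula_base_ge(1)[OF valid ne] by (simp add: Sigma_pow_ge)
        then show ?thesis
          using value_le_opened[of "Chain 3" H] G vH eq by simp
      next
        case no_long: False
        \<comment> \<open>The exceptional shape, one 3-chain and loops: the bonus of the rest jumps to 8, and
          the 3-chain has margin 3 because the rest has value 4 by its residue.\<close>
        have loopH: "has_loop H" using nonempty_kinds[OF valid ne] H no_long by simp
        then have tb: "terminal_bonus G = 6" "terminal_bonus H = 8"
          using bonus bonusH no_long H one G by simp_all
        then have cH: "controlled_value H = controlled_value G + 3"
          using G by (simp add: controlled_value_eq)
        have "controlled_value G mod 4 = 1" using controlled_value_mod4[of G] mod tb by presburger
        then have cG: "controlled_value G \<le> 1" using c by presburger
        have bH: "boxes H mod 4 = 0" using mod by (simp add: G) presburger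
        then have "4 dvd core_formula H"
          using core_formula_mod4[OF valid H(1)] by presburger
        moreover have "core_formula H \<ge> 2"
          using fH H core_formula_base_ge(1)[OF valid ne] by (simp add: Sigma_pow_ge)
        moreover have "core_formula H \<le> 4"
          using core_formula_small[OF valid ne] core_formula_large[OF valid ne] H(1) cH cG
          by fastforce
        ultimately have "core_formula H = 4" by presburger
        then have "value_of G \<le> 3" using value_le_opened[of "Chain 3" H] G vH by simp
        moreover have "core_formula G \<ge> 2"
          using fG no_long f0 core_formula_base_ge(1)[OF assms(1,2) t1]
          by (simp add: surplus_threes_def Sigma_pow_ge)
        moreover have "odd (core_formula G)" using even mod by presburger
        ultimately show ?thesis by presburger
      qed
    qed
  qed
  show "core_formula G \<le> value_of G"
  proof (rule value_ge_opened[OF assms(2)])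
    fix C H assume G: "G = add_mset C H"
    have valid: "valid_position H" "valid_component C" using assms(1) G by simp_all
    let ?m = "int (len C) - left_over C + \<bar>value_of H - left_over C\<bar>"
    have parity: "even ?m \<longleftrightarrow> even (core_formula G)"
    proof -
      have "even ?m \<longleftrightarrow> even (int (len C) + value_of H)"
        using left_over_pos[of C] by auto
      then show ?thesis using value_parity[of H] even G by simp
    qed
    have mod4: "4 dvd value_of H - int (boxes H)" if "tame H" "threes H = 0" "even (boxes H)"
      using core_formula_mod4[OF valid(1) that(2,3)] IHtame[OF G that(1)] by simp
    have nonneg: "\<bar>value_of H - left_over C\<bar> \<ge> 0" by simp
    show "core_formula G \<le> ?m"
    proof (cases "C = Loop 4")
      case True
      then show ?thesis using IHtame[OF G] Loop4 G by (simp add: core_formula_Loop4)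
    next
      case not4: False
      show ?thesis
      proof (rule ccontr)
        assume less: "\<not> ?thesis"
        have tameH: "tame H" if "threes H = 0" using that by (simp add: tame_def)
        have le4: "core_formula G \<le> 4" using range by simp
        \<comment> \<open>By parity a better move gains at least 2.\<close>
        have "?m \<noteq> core_formula G - 1" using parity by presburger
        then have gap: "?m \<le> core_formula G - 2" using less by linarith
        consider (three) "C = Chain 3" | (two) "C = Loop 6 \<or> C = Chain 4"
          | (big) "int (len C) - left_over C \<ge> 3"
        proof (cases C)
          case (Chain n)
          then have "n = 3 \<or> n = 4 \<or> n \<ge> 5" using valid(2) by auto
          then show ?thesis using Chain that by auto
        next
          case (Loop n)
          then have "n = 6 \<or> n \<ge> 8" using valid(2) not4 by auto
          then show ?thesis using Loop that by auto
        qed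
        then show False
        proof cases
          case three
          then have mod: "boxes G mod 4 = 3" "threes H = 0" using assms(3) G by (auto simp: tame_def)
          then have bH: "boxes H mod 4 = 0" using three by (simp add: G) presburger
          then have "even (boxes H)" by presburger
          then have "4 dvd value_of H" using mod4[OF tameH] mod(2) bH by presburger
          then have "value_of H \<noteq> 2" by presburger
          then have "?m \<ge> 2" using three by simp
          then have "core_formula G = 4" using gap le4 by linarith
          moreover have "odd (core_formula G)" using even mod(1) by presburger
          ultimately show ?thesis by simp
        next
          case two
          \<comment> \<open>The margin 2 is possible only if the rest is worth exactly the boxes left over,
            but then the sizes of both positions contradict each other modulo 4.\<close>
          then have len: "int (len C) = left_over C + 2" and k: "even (left_over C)" by auto
          have c4: "core_formula G = 4" and vH: "value_of H = left_over C"
            using len gap le4 nonneg by linarith+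
          have ev: "even (boxes G)" using even c4 by simp
          then have t0: "threes G = 0" using assms(3) unfolding tame_def by presburger
          have "4 dvd int (boxes G)"
            using core_formula_mod4[OF assms(1) t0 ev] c4 by presburger
          moreover have bG: "int (boxes G) = left_over C + 2 + int (boxes H)" using len G by simp
          moreover have "4 dvd left_over C - int (boxes H)"
          proof -
            have "threes H = 0" using t0 G by (simp split: if_splits)
            moreover have "even (boxes H)" using bG ev k by presburger
            ultimately show ?thesis using mod4[OF tameH] vH by simp
          qed
          ultimately show ?thesis using k by presburger
        next
          case big
          then show ?thesis using gap le4 nonneg by linarith
        qed
      qed
    qed
  qed
qed

text \<open>
  Opening a 3-chain is a good move because the rest has a value in \<open>{0..4}\<close>. If the
  size is odd, the rest has value 2, except when it falls under the second part of the theorem;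
  then \<open>c = -1\<close> and opening a 4-loop leaves a rest of value 3. If the size is even,
  the rest has value 1 or 3, and margin 2 results. Margin 0 would require a 4-loop with a rest of
  value 4; since that rest is not tame, its value can only be its controlled value, which
  forces \<open>c = 0\<close>.
\<close>

lemma value_of_remaining:
  assumes "valid_position G" "G \<noteq> {#}" "\<not> tame G" "\<not> vanishing G"
    and IH: "\<And>C H. G = add_mset C H \<Longrightarrow> evaluated H"
    and c: "controlled_value G < 2"
  shows "value_of G = (if odd (boxes G) then 1 else 2)"
proof -
  note bonus = terminal_bonus_eq[OF assms(1,2)]
  have t: "threes G > 0" and notthree: "threes G = 1 \<Longrightarrow> boxes G mod 4 \<noteq> 3"
    using assms(3) by (auto simp: tame_def)
  obtain H where G: "G = add_mset (Chain 3) H"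
    using t by (metis count_greater_zero_iff insert_DiffM)
  have valid: "valid_position H" using assms(1) G by simp
  have ne: "H \<noteq> {#}"
  proof
    assume "H = {#}"
    then show False using c bonus G by (simp add: controlled_value_eq)
  qed
  note evH = IH[OF G] and bonusH = terminal_bonus_eq[OF valid ne]
  have margin: "value_of G \<le> 1 + \<bar>value_of H - 2\<bar>"
    using value_le_opened[of "Chain 3" H] G by simp
  have parity: "even (value_of G) \<longleftrightarrow> even (boxes G)" by (rule value_parity)
  have cH: "controlled_value H = controlled_value G + 1
    \<or> threes H = 0 \<and> controlled_value H = controlled_value G + 3"
    using bonus bonusH nonempty_kinds[OF valid ne] G
    by (auto simp: controlled_value_eq split: if_splits)
  show ?thesis
  proof (cases "odd (boxes G)")
    case True
    have odd: "odd (controlled_value G)" "even (boxes H)"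
      using True controlled_value_even[of G] G by auto
    have "value_of G \<le> 1"
    proof (cases "threes H = 0")
      case True
      then have tame: "tame H" by (simp add: tame_def)
      then have vH: "value_of H = core_formula H" using evH by (simp add: evaluated_def)
      have "boxes G mod 4 = 1" using notthree True G \<open>odd (boxes G)\<close> by simp presburger
      then have "boxes H mod 4 = 2" using G by simp presburger
      then have mod: "value_of H mod 4 = 2"
        using core_formula_mod4[OF valid True odd(2)] vH by presburger
      have "value_of H \<in> {0..4}"
        using core_formula_small[OF valid ne] core_formula_large[OF valid ne] True vH cH c
        by fastforce
      then have "value_of H = 2" using mod by simp presburger
      then show ?thesis using margin by simp
    next
      case False
      then have cH': "controlled_value H = controlled_value G + 1" using cH by simp
      have nt: "\<not> tame H" using False odd(2) by (auto simp: tame_def) presburger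
      show ?thesis
      proof (cases "vanishing H")
        case False
        then have "value_of H = 2"
          using evH nt cH' c odd by (cases "controlled_value H \<ge> 2") (auto simp: evaluated_def)
        then show ?thesis using margin by simp
      next
        case van: True
        then have cG: "controlled_value G = -1" using cH' by (simp add: vanishing_def)
        have "Loop 4 \<in># G" using van G by (simp add: vanishing_def)
        then obtain K where K: "G = add_mset (Loop 4) K" by (metis insert_DiffM)
        have Kv: "valid_position K" "K \<noteq> {#}" "threes K = threes G" using assms(1) K t by auto
        \<comment> \<open>If the bonus dropped with the loop, removing the 3-chain would leave the position
          with a 4-loop and two 3-chains, which is not vanishing.\<close>
        have "terminal_bonus K = terminal_bonus G"
        proof (rule ccontr)
          assume "terminal_bonus K \<noteq> terminal_bonus G"
          then have no: "\<not> has_long K" "\<not> has_loop K" "terminal_bonus G = 6"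
            using bonus terminal_bonus_eq[OF Kv(1,2)] Kv(3) t K by (auto split: if_splits)
          then have Keq: "K = replicate_mset (threes G) (Chain 3)" using only_threes Kv by metis
          have "keep_margin K = - int (threes G)" by (subst Keq) simp
          then have "threes G = 3" using cG no K by (simp add: controlled_value_eq)
          then have "K = replicate_mset 3 (Chain 3)" using Keq by metis
          then have "G = {#Loop 4, Chain 3, Chain 3, Chain 3#}"
            unfolding K by (simp add: numeral_3_eq_3)
          then have "H = {#Loop 4, Chain 3, Chain 3#}" using G by simp
          then show False using van by (simp add: vanishing_def)
        qed
        then have "controlled_value K = 3" using cG K by (simp add: controlled_value_eq)
        then have "value_of K = 3" using IH[OF K] by (simp add: evaluated_def)
        then show ?thesis using value_le_opened[of "Loop 4" K] K by simp
      qed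
    qed
    then show ?thesis using value_nonneg[OF assms(1)] parity True by simp presburger
  next
    case even: False
    then have oddH: "odd (boxes H)" using G by simp
    have "value_of H \<in> {0..4}"
    proof (cases "controlled_value H \<ge> 2")
      case True
      then show ?thesis using evH cH c even controlled_value_even[of G]
        by (auto simp: evaluated_def)
    next
      case False
      then show ?thesis
        using evH oddH core_formula_small[OF valid ne tame_threes_le]
        by (cases "tame H"; cases "vanishing H") (auto simp: evaluated_def)
    qed
    then have le: "value_of G \<le> 2" using margin value_parity[of H] oddH by simp presburger
    have "value_of G \<noteq> 0"
    proof
      assume "value_of G = 0"
      then obtain C K where K: "G = add_mset C K"
        and zero: "0 = int (len C) - left_over C + \<bar>value_of K - left_over C\<bar>"
        using value_obtain[OF assms(2)] by metis
      have Kv: "valid_position K" "valid_component C" using assms(1) K by auto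
      have C: "C = Loop 4" using zero Kv(2) by (cases C) auto
      then have v4: "value_of K = 4" using zero by simp
      have K3: "threes K = threes G" "K \<noteq> {#}" using K C t by auto
      have nt: "\<not> tame K" using assms(3) K C by (simp add: tame_def)
      have cK: "controlled_value K = controlled_value G + 4 \<or>
          controlled_value K = controlled_value G + 2"
        using bonus terminal_bonus_eq[OF Kv(1) K3(2)] K3 t K C
        by (auto simp: controlled_value_eq split: if_splits)
      show False
      proof (cases "controlled_value K \<ge> 2")
        case True
        then have "controlled_value K = 4" using IH[OF K] v4 by (simp add: evaluated_def)
        then have c0: "controlled_value G = 0" using cK c by auto
        then have "G = {#Loop 4, Chain 3, Chain 3#}" using assms(4) K C by (simp add: vanishing_def)
        then have "K = {#Chain 3, Chain 3#}" using K C by simp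
        then show False using \<open>controlled_value K = 4\<close> terminal_bonus_eq[OF Kv(1) K3(2)]
          by (simp add: controlled_value_eq)
      next
        case False
        then show False
          using IH[OF K] v4 nt by (cases "vanishing K") (auto simp: evaluated_def split: if_splits)
      qed
    qed
    then show ?thesis using le value_nonneg[OF assms(1)] parity even by simp presburger
  qed
qed

lemma evaluated_valid:
  assumes "valid_position G"
  shows "evaluated G"
  using assms
proof (induction G rule: measure_induct_rule[where f = size])
  case (less G)
  show ?case
  proof (cases "G = {#}")
    case True
    then show ?thesis by (simp add: evaluated_empty)
  next
    case False
    have IH: "evaluated H" if "G = add_mset C H" for C H using less that by simp
    note facts = less.prems False
    have "vanishing G \<Longrightarrow> 0 < fours G" "vanishing G \<Longrightarrow> controlled_value G = 0"
      by (simp_all add: vanishing_def count_greater_zero_iff)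
    then have "value_of G = 0" if "vanishing G"
      using that value_of_vanishing[OF less.prems that _ IH] value_of_tame[OF facts _ IH]
        core_formula_large[OF facts] by (cases "threes G = 0") (auto simp: tame_def)
    moreover have "value_of G = core_formula G" if "tame G"
      using value_of_tame[OF facts that IH] value_of_large[OF facts IH]
        core_formula_large[OF facts tame_threes_le[OF that]] by fastforce
    moreover have "value_of G = controlled_value G" if "controlled_value G \<ge> 2"
      using value_of_large[OF facts IH that] .
    moreover have "value_of G = (if odd (boxes G) then 1 else 2)"
      if "\<not> controlled_value G \<ge> 2" "\<not> vanishing G" "\<not> tame G"
    proof -
      have "controlled_value G < 2" using that(1) by simp
      from value_of_remaining[OF facts that(3,2) IH this] show ?thesis .
    qed
    ultimately show ?thesis unfolding evaluated_def by blast
  qed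
qed

theorem theorem4p2:
  fixes G :: position and v c :: int and \<theta> f s \<theta>' :: nat
  assumes "valid_position G" and "G \<noteq> {#}"
    and "v = value_of G" and "c = controlled_value G"
    and "\<theta> = count G (Chain 3)" and "f = count G (Loop 4)" and "s = count G (Loop 6)"
    and "\<theta>' = count (G - core G) (Chain 3)"
  shows "(c \<ge> 2 \<longrightarrow> v = c)
    \<and> (c = 0 \<and> Loop 4 \<in># G \<and> G \<noteq> {#Loop 4, Chain 3, Chain 3#} \<longrightarrow> v = 0)
    \<and> (\<theta> = 0 \<or> (\<theta> = 1 \<and> boxes G mod 4 = 3) \<longrightarrow>
         \<theta>' \<in> {0, 1} \<and>
         v = (Phi_op ^^ f) ((Theta_op ^^ \<theta>') ((Sigma_op ^^ s) (controlled_value (core G)))))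
    \<and> (\<not> c \<ge> 2
        \<and> \<not> (c = 0 \<and> Loop 4 \<in># G \<and> G \<noteq> {#Loop 4, Chain 3, Chain 3#})
        \<and> \<not> (\<theta> = 0 \<or> (\<theta> = 1 \<and> boxes G mod 4 = 3)) \<longrightarrow>
         v = (if odd (boxes G) then 1 else 2))"
proof -
  have "\<theta>' \<in> {0, 1}" if "tame G"
    using tame_threes_le[OF that] surplus_threes_le[of G] assms(8) by (auto simp: count_off_core)
  then show ?thesis
    using evaluated_valid[OF assms(1)]
    unfolding evaluated_def vanishing_def tame_def core_formula_def assms(3-8) by blast
qed

end
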